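(* Let $k\ge 2$ be any integer (with $k\le n$). Let $\{\mathcal{B}_1,\mathcal{B}_2,\dots,\mathcal{B}_{\mathrm{C}_n^k}\}$ denote all possible combinations of the index vectors choosing $k$ items from $\{1,\dots,n\}$ without repetition. For all $i\in\{1,\dots,\mathrm{C}_n^k\}$, define $$\mathcal{W}_i \triangleq \mathrm{I}_n+\mathrm{U}_{\mathcal{B}_i}(\mathcal{V}_i-\mathrm{I}_k)\mathrm{U}_{\mathcal{B}_i}^{\mathsf T}=\mathrm{U}_{\mathcal{B}_i}\mathcal{V}_i\mathrm{U}_{\mathcal{B}_i}^{\mathsf T}+\mathrm{U}_{\mathcal{B}_i^c}\mathrm{U}_{\mathcal{B}_i^c}^{\mathsf T},$$ where $\mathcal{V}_i\in\mathrm{St}(k,k)$. Then: (a) Any matrix $\mathbf{D}\in\mathrm{St}(n,n)$ can be expressed as $\mathbf{D}=\mathcal{W}_{\mathrm{C}_n^k}\cdots\mathcal{W}_2\mathcal{W}_1$ for a suitable choice of $\mathcal{W}_i$ (equivalently, of $\mathcal{V}_i$). Furthermore, if $\mathcal{V}_i=\mathrm{I}_k$ for all $i$, then $\mathbf{D}=\mathrm{I}_n$. (b) For any fixed reference point $\mathbf{X}^0\in\mathrm{St}(n,r)$, every $\mathbf{X}\in\mathrm{St}(n,r)$ can be expressed as $\mathbf{X}=\mathcal{W}_{\mathrm{C}_n^k}\cdots\mathcal{W}_2\mathcal{W}_1\mathbf{X}^0$ for suitable $\mathcal{W}_i$.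
   Context: Here $n\ge r$ and $n\ge 2$ are integers; $\mathrm{St}(n,r)=\{\mathbf{X}\in\mathbb{R}^{n\times r}:\mathbf{X}^{\mathsf T}\mathbf{X}=\mathrm{I}_r\}$; $\mathrm{I}_m$ is the $m\times m$ identity matrix; $\mathrm{C}_n^k$ is the number of combinations choosing $k$ items from $n$ without repetition, i.e. $\binom nk$. For an index vector $\mathcal{B}\in\mathbb{N}^k$ with distinct entries in $\{1,\dots,n\}$ and complementary index vector $\mathcal{B}^c\in\mathbb{N}^{n-k}$ (so that $[\mathcal{B},\mathcal{B}^c]$ is a partition of $[1,2,\dots,n]$), $\mathrm{U}_{\mathcal{B}}\in\mathbb{R}^{n\times k}$ is defined by $(\mathrm{U}_{\mathcal{B}})_{ji}=1$ if the $i$-th entry of $\mathcal{B}$ equals $j$ and $0$ otherwise, and $\mathrm{U}_{\mathcal{B}^c}\in\mathbb{R}^{n\times(n-k)}$ is defined in the same way from $\mathcal{B}^c$ (absent when $k=n$).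
   Formalization: The combinations B_1,...,B_{C_n^k} are assumed to be listed in lexicographic order (as sets); for an arbitrary listing the claim fails, e.g. n=4, k=2 with the order {3,4},{2,3},{1,4},{2,4},{1,3},{1,2}. *)

theory Defs
  imports "Jordan_Normal_Form.Matrix"
begin

definition St :: "nat \<Rightarrow> nat \<Rightarrow> real mat set" where
  "St n r = {X \<in> carrier_mat n r. transpose_mat X * X = 1\<^sub>m r}"

text \<open>Index vectors are lists with 1-based entries; matrix rows and columns and list
  positions are 0-based, hence the shift by one.\<close>

definition index_vector :: "nat \<Rightarrow> nat \<Rightarrow> nat list \<Rightarrow> bool" where
  "index_vector n k B \<longleftrightarrow> length B = k \<and> distinct B \<and> set B \<subseteq> {1..n}"

definition complementary :: "nat \<Rightarrow> nat list \<Rightarrow> nat list \<Rightarrow> bool" where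
  "complementary n B Bc \<longleftrightarrow> distinct Bc \<and> set Bc = {1..n} - set B"

definition U :: "nat \<Rightarrow> nat list \<Rightarrow> real mat" where
  "U n B = mat n (length B) (\<lambda>(j, i). if B ! i = Suc j then 1 else 0)"

definition W :: "nat \<Rightarrow> nat list \<Rightarrow> real mat \<Rightarrow> real mat" where
  "W n B V = 1\<^sub>m n + U n B * (V - 1\<^sub>m (length B)) * transpose_mat (U n B)"

text \<open>\<open>W_prod n B V m\<close> is \<open>W_m \<cdots> W_2 W_1\<close>, the factor with the largest index leftmost.\<close>

primrec W_prod :: "nat \<Rightarrow> (nat \<Rightarrow> nat list) \<Rightarrow> (nat \<Rightarrow> real mat) \<Rightarrow> nat \<Rightarrow> real mat" where
  "W_prod n B V 0 = 1\<^sub>m n"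
| "W_prod n B V (Suc m) = W n (B (Suc m)) (V (Suc m)) * W_prod n B V m"

text \<open>\<open>B 1, \<dots>, B (n choose k)\<close> represent every k-element subset of \<open>{1..n}\<close> exactly once; the order
  of the entries inside each \<open>B i\<close> is arbitrary.\<close>

definition all_combinations :: "nat \<Rightarrow> nat \<Rightarrow> (nat \<Rightarrow> nat list) \<Rightarrow> bool" where
  "all_combinations n k B \<longleftrightarrow>
     (\<forall>i\<in>{1..n choose k}. index_vector n k (B i)) \<and>
     bij_betw (\<lambda>i. set (B i)) {1..n choose k} {S. S \<subseteq> {1..n} \<and> card S = k}"

text \<open>The combinations are listed in lexicographic order (as sets, so each \<open>B i\<close> is compared after
  sorting). Some convention on the listing is needed: for \<open>n = 4\<close>, \<open>k = 2\<close> and the listing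
  \<open>{3,4}, {2,3}, {1,4}, {2,4}, {1,3}, {1,2}\<close> the products \<open>W_6 \<cdots> W_1\<close> do not exhaust \<open>St 4 4\<close>.
  They miss the orthogonal matrix with diagonal 2x2 blocks 0 and both off-diagonal blocks equal to
  \<open>1 / sqrt 2\<close> times the matrix with rows \<open>(1, 1)\<close> and \<open>(1, -1)\<close>.\<close>

definition lex_listed :: "nat \<Rightarrow> nat \<Rightarrow> (nat \<Rightarrow> nat list) \<Rightarrow> bool" where
  "lex_listed n k B \<longleftrightarrow>
     (\<forall>i j. 1 \<le> i \<and> i < j \<and> j \<le> n choose k \<longrightarrow> (sort (B i), sort (B j)) \<in> lex less_than)"

end

(* This is a QR elimination that uses Householder reflections supported on the k-subsets. Factors are
   split off D from the right, D = E * W_m ... W_1, so that D is gradually reduced to E. A subset S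
   with minimum p is used to replace row p of E on S by a nonnegative multiple of the p-th unit
   vector. A later subset with the same minimum does not destroy the zeros obtained, and once all
   subsets with minimum p have been used, row p and hence column p of E are unit vectors, which
   later subsets do not meet. The lexicographic listing is needed only for the minima to increase.
   At the end E is supported on the last subset {n-k+1..n} and can be absorbed in the last factor.
   The second half follows because the orthogonal group acts transitively on St n r. *)

theory Submission
  imports Defs "Jordan_Normal_Form.Determinant"
begin

section \<open>Orthogonal matrices and their action on vectors\<close>

lemma St_carrier: "X \<in> St n r \<Longrightarrow> X \<in> carrier_mat n r"
  by (simp add: St_def)

text \<open>For square matrices a left inverse is also a right inverse, so the rows are orthonormal
  as well as the columns.\<close>

lemma St_square_transpose:
  assumes "E \<in> St n n"
  shows "E * transpose_mat E = 1\<^sub>m n"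
  using assms mat_mult_left_right_inverse[of "transpose_mat E" n E] by (auto simp: St_def)

lemma St_mult:
  assumes "E \<in> St n n" "F \<in> St n r"
  shows "E * F \<in> St n r"
proof -
  have E: "E \<in> carrier_mat n n" "transpose_mat E * E = 1\<^sub>m n"
    and F: "F \<in> carrier_mat n r" "transpose_mat F * F = 1\<^sub>m r"
    using assms by (auto simp: St_def)
  have "transpose_mat (E * F) * (E * F) = transpose_mat F * (transpose_mat E * (E * F))"
    using E(1) F(1) by (simp add: transpose_mult[OF E(1) F(1)] assoc_mult_mat[of _ r n _ n _ r])
  also have "transpose_mat E * (E * F) = (transpose_mat E * E) * F"
    using E(1) F(1) by simp
  also have "transpose_mat F * \<dots> = 1\<^sub>m r"
    using E F by simp
  finally show ?thesis using E(1) F(1) by (auto simp: St_def)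
qed

lemma one_in_St: "1\<^sub>m n \<in> St n n"
  by (simp add: St_def)

lemma mult_mat_unit_vec:
  assumes "A \<in> carrier_mat n m" "j < m"
  shows "A *\<^sub>v unit_vec m j = col (A :: 'a :: semiring_1 mat) j"
  using assms by (intro eq_vecI) auto

text \<open>Unit vectors pick out the columns. Later matrix identities are reduced in this way to
  entries of vectors, where coordinates inside and outside the index set can be separated.\<close>

lemma mat_vec_eqI:
  assumes "A \<in> carrier_mat n m" "C \<in> carrier_mat n m"
    and "\<And>z. z \<in> carrier_vec m \<Longrightarrow> A *\<^sub>v z = C *\<^sub>v z"
  shows "A = (C :: 'a :: semiring_1 mat)"
proof (rule mat_col_eqI)
  fix j assume "j < dim_col C"
  then have j: "j < m" using assms by auto
  have "A *\<^sub>v unit_vec m j = C *\<^sub>v unit_vec m j" by (rule assms) simp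
  then show "col A j = col C j"
    using mult_mat_unit_vec[OF assms(1) j] mult_mat_unit_vec[OF assms(2) j] by simp
qed (use assms in auto)

section \<open>Householder reflections\<close>

text \<open>For \<open>u = 0\<close> the quotient is \<open>0\<close> and this is the identity matrix.\<close>

definition householder :: "nat \<Rightarrow> real vec \<Rightarrow> real mat" where
  "householder n u = mat n n (\<lambda>(i, j). (if i = j then 1 else 0) - 2 * u $ i * u $ j / (u \<bullet> u))"

lemma householder_carrier [simp]: "householder n u \<in> carrier_mat n n"
  by (simp add: householder_def)

lemma householder_transpose: "transpose_mat (householder n u) = householder n u"
  by (rule eq_matI) (auto simp: householder_def)

lemma householder_mult_vec:
  assumes "u \<in> carrier_vec n" "z \<in> carrier_vec n"
  shows "householder n u *\<^sub>v z = z - (2 * (u \<bullet> z) / (u \<bullet> u)) \<cdot>\<^sub>v u"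
proof (rule eq_vecI)
  fix i assume "i < dim_vec (z - (2 * (u \<bullet> z) / (u \<bullet> u)) \<cdot>\<^sub>v u)"
  then have i: "i < n" using assms by auto
  have "(householder n u *\<^sub>v z) $ i
      = (\<Sum>j\<in>{0..<n}. ((if i = j then 1 else 0) - 2 * u $ i * u $ j / (u \<bullet> u)) * z $ j)"
    using i assms by (simp add: householder_def scalar_prod_def[of _ z])
  also have "\<dots> = (\<Sum>j\<in>{0..<n}. (if i = j then z $ j else 0))
      - (\<Sum>j\<in>{0..<n}. 2 * u $ i / (u \<bullet> u) * (u $ j * z $ j))"
    by (subst sum_subtractf[symmetric], rule sum.cong) (auto simp: algebra_simps)
  also have "(\<Sum>j\<in>{0..<n}. 2 * u $ i / (u \<bullet> u) * (u $ j * z $ j)) = 2 * u $ i / (u \<bullet> u) * (u \<bullet> z)"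
    using assms by (simp only: sum_distrib_left[symmetric]) (simp add: scalar_prod_def[of u z])
  also have "(\<Sum>j\<in>{0..<n}. if i = j then z $ j else 0) = z $ i"
    using i by simp
  finally show "(householder n u *\<^sub>v z) $ i = (z - (2 * (u \<bullet> z) / (u \<bullet> u)) \<cdot>\<^sub>v u) $ i"
    using i assms by simp
qed (use assms in \<open>auto simp: householder_def\<close>)

text \<open>Over the reals conjugation is the identity, so definiteness of the conjugate square
  carries over.\<close>

lemma scalar_prod_self_eq_0_iff:
  assumes "(u :: real vec) \<in> carrier_vec n"
  shows "u \<bullet> u = 0 \<longleftrightarrow> u = 0\<^sub>v n"
  using assms conjugate_square_eq_0_vec[OF assms] by (simp add: conjugate_vec_def vec_eq_iff)

text \<open>A reflection is symmetric and an involution: it reverses the component along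
  \<open>u\<close>, so the second application adds back what the first subtracted.\<close>

lemma householder_in_St:
  assumes u: "u \<in> carrier_vec n"
  shows "householder n u \<in> St n n"
proof -
  have "householder n u * householder n u = 1\<^sub>m n"
  proof (rule mat_vec_eqI)
    fix z :: "real vec" assume z: "z \<in> carrier_vec n"
    let ?c = "2 * (u \<bullet> z) / (u \<bullet> u)"
    have w: "z - ?c \<cdot>\<^sub>v u \<in> carrier_vec n" using u z by simp
    have "u \<bullet> (z - ?c \<cdot>\<^sub>v u) = u \<bullet> z - ?c * (u \<bullet> u)"
      using u z by (simp add: scalar_prod_minus_distrib)
    then have d: "u \<bullet> (z - ?c \<cdot>\<^sub>v u) = - (u \<bullet> z)" if "u \<bullet> u \<noteq> 0"
      using that by simp
    have "householder n u * householder n u *\<^sub>v z = householder n u *\<^sub>v (householder n u *\<^sub>v z)"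
      using z by (intro assoc_mult_mat_vec[of _ n n _ n]) auto
    also have "\<dots> = (z - ?c \<cdot>\<^sub>v u) - (2 * (u \<bullet> (z - ?c \<cdot>\<^sub>v u)) / (u \<bullet> u)) \<cdot>\<^sub>v u"
      by (simp add: householder_mult_vec u z w)
    \<comment> \<open>If \<open>u \<bullet> u = 0\<close>, division by zero gives 0 and nothing is
      subtracted.\<close>
    also have "\<dots> = z"
      using u z d by (cases "u \<bullet> u = 0") auto
    finally show "householder n u * householder n u *\<^sub>v z = 1\<^sub>m n *\<^sub>v z"
      using z by simp
  qed (auto intro: mult_carrier_mat[of _ n n])
  then show ?thesis by (simp add: St_def householder_transpose)
qed

text \<open>Equal lengths give \<open>?u \<bullet> ?u = 2 * (?u \<bullet> y)\<close> for
  \<open>?u = y - x\<close>, so the reflection subtracts exactly \<open>?u\<close> from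
  \<open>y\<close>.\<close>

lemma householder_reflects:
  assumes y: "y \<in> carrier_vec n" and x: "x \<in> carrier_vec n" and eq: "y \<bullet> y = x \<bullet> x"
  shows "householder n (y - x) *\<^sub>v y = x"
proof -
  let ?u = "y - x"
  have u: "?u \<in> carrier_vec n" using x y by simp
  have "?u \<bullet> ?u = y \<bullet> y - y \<bullet> x - (x \<bullet> y - x \<bullet> x)" "?u \<bullet> y = y \<bullet> y - x \<bullet> y"
    using x y u by (simp_all add: scalar_prod_minus_distrib minus_scalar_prod_distrib)
  then have uu: "?u \<bullet> ?u = 2 * (?u \<bullet> y)"
    using eq comm_scalar_prod[OF x y] by simp
  show ?thesis
  proof (cases "?u \<bullet> ?u = 0")
    \<comment> \<open>Here \<open>y = x\<close> and the reflection degenerates to the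
      identity.\<close>
    case True
    then have "?u = 0\<^sub>v n" using scalar_prod_self_eq_0_iff[OF u] by simp
    then have "y = x" using x y by (auto simp: vec_eq_iff)
    then show ?thesis using True x y u by (simp add: householder_mult_vec) auto
  next
    case False
    then have "2 * (?u \<bullet> y) / (?u \<bullet> ?u) = 1" using uu by simp
    then show ?thesis using x y u by (simp add: householder_mult_vec) auto
  qed
qed

lemma householder_fixes:
  assumes "u \<in> carrier_vec n" "z \<in> carrier_vec n" "u \<bullet> z = 0"
  shows "householder n u *\<^sub>v z = z"
  using assms by (simp add: householder_mult_vec) auto

section \<open>Transitivity of the orthogonal group on orthonormal frames\<close>

lemma St_col_scalar_prod:
  assumes "X \<in> St n r" "i < r" "j < r"
  shows "col X i \<bullet> col X j = (if i = j then 1 else 0)"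
proof -
  have "col X i \<bullet> col X j = (transpose_mat X * X) $$ (i, j)"
    using assms St_carrier[OF assms(1)] by simp
  also have "transpose_mat X * X = 1\<^sub>m r"
    using assms(1) by (simp add: St_def)
  finally show ?thesis using assms by simp
qed

lemma St_mult_col_scalar_prod:
  assumes "D \<in> St n n" "X \<in> St n r" "i < r" "j < r"
  shows "(D *\<^sub>v col X i) \<bullet> (D *\<^sub>v col X j) = (if i = j then 1 else 0)"
proof -
  have "col (D * X) l = D *\<^sub>v col X l" if "l < r" for l
    using assms that by (intro col_mult2[of D n n X r]) (auto simp: St_def)
  then show ?thesis
    using St_col_scalar_prod[OF St_mult[OF assms(1,2)] assms(3,4)] assms(3,4) by simp
qed

lemma St_transitive:
  assumes X: "X \<in> St n r" and Y: "Y \<in> St n r"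
  shows "\<exists>D\<in>St n n. Y = D * X"
proof -
  \<comment> \<open>Match one column at a time: the reflection that corrects column \<open>m\<close> fixes the columns matched
    before, since they are orthogonal to both vectors it exchanges.\<close>
  have "\<exists>D\<in>St n n. \<forall>j<m. D *\<^sub>v col X j = col Y j" if "m \<le> r" for m
    using that
  proof (induction m)
    case 0
    then show ?case using one_in_St by auto
  next
    case (Suc m)
    then obtain D where D: "D \<in> St n n" "\<And>j. j < m \<Longrightarrow> D *\<^sub>v col X j = col Y j"
      by auto
    have m: "m < r" using Suc by simp
    have cX: "col X j \<in> carrier_vec n" and cY: "col Y j \<in> carrier_vec n" for j
      using St_carrier[OF X] St_carrier[OF Y] by auto
    have cD: "D \<in> carrier_mat n n" using D(1) by (rule St_carrier)
    let ?y = "D *\<^sub>v col X m"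
    let ?u = "?y - col Y m"
    let ?H = "householder n ?u"
    have y: "?y \<in> carrier_vec n" using mult_mat_vec_carrier[OF cD cX] .
    have u: "?u \<in> carrier_vec n" using y cY by simp
    have HD: "?H * D *\<^sub>v col X j = ?H *\<^sub>v (D *\<^sub>v col X j)" for j
      using assoc_mult_mat_vec[OF householder_carrier cD cX] .
    have "?y \<bullet> ?y = col Y m \<bullet> col Y m"
      by (simp add: St_mult_col_scalar_prod[OF D(1) X m m] St_col_scalar_prod[OF Y m m])
    then have new: "?H *\<^sub>v ?y = col Y m" by (rule householder_reflects[OF y cY])
    have old: "?H *\<^sub>v (D *\<^sub>v col X j) = col Y j" if j: "j < m" for j
    proof -
      have jr: "j < r" using j m by simp
      have "?u \<bullet> col Y j = ?y \<bullet> col Y j - col Y m \<bullet> col Y j"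
        using y cY by (intro minus_scalar_prod_distrib) auto
      also have "?y \<bullet> col Y j = ?y \<bullet> (D *\<^sub>v col X j)" using D(2)[OF j] by simp
      also have "\<dots> = 0" using St_mult_col_scalar_prod[OF D(1) X m jr] j by simp
      also have "col Y m \<bullet> col Y j = 0" using St_col_scalar_prod[OF Y m jr] j by simp
      finally show ?thesis using D(2)[OF j] householder_fixes[OF u cY] by simp
    qed
    have "\<forall>j<Suc m. ?H * D *\<^sub>v col X j = col Y j"
      using HD new old less_Suc_eq by auto
    moreover have "?H * D \<in> St n n"
      using St_mult[OF householder_in_St[OF u] D(1)] .
    ultimately show ?case by blast
  qed
  from this[of r] obtain D where D: "D \<in> St n n" "\<And>j. j < r \<Longrightarrow> D *\<^sub>v col X j = col Y j"
    by auto
  have "Y = D * X"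
  proof (rule mat_col_eqI)
    fix j assume "j < dim_col (D * X)"
    then have j: "j < r" using St_carrier[OF X] by simp
    then have "col (D * X) j = D *\<^sub>v col X j"
      using St_carrier[OF X] St_carrier[OF D(1)] by (intro col_mult2) auto
    then show "col Y j = col (D * X) j" using D(2)[OF j] by simp
  qed (use St_carrier[OF X] St_carrier[OF Y] St_carrier[OF D(1)] in auto)
  with D(1) show ?thesis by blast
qed

section \<open>Selection matrices\<close>

lemma U_carrier [simp]: "U n B \<in> carrier_mat n (length B)"
  by (simp add: U_def)

lemma U_transpose_carrier [simp]: "transpose_mat (U n B) \<in> carrier_mat (length B) n"
  by simp

lemma dim_U [simp]: "dim_row (U n B) = n" "dim_col (U n B) = length B"
  by (simp_all add: U_def)

lemma W_carrier [simp]: "V \<in> carrier_mat (length B) (length B) \<Longrightarrow> W n B V \<in> carrier_mat n n"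
  unfolding W_def by (intro add_carrier_mat mult_carrier_mat) auto

lemma index_vector_entry:
  assumes "index_vector n k B" "a < k"
  obtains j where "j < n" "B ! a = Suc j"
proof -
  have "B ! a \<in> {1..n}" using assms nth_mem[of a B] unfolding index_vector_def by blast
  then show ?thesis using that[of "B ! a - 1"] by auto
qed

text \<open>Since the entries of \<open>B\<close> are distinct, the columns of \<open>U n B\<close>
  are distinct unit vectors.\<close>

lemma U_transpose_mult_U:
  assumes "index_vector n k B"
  shows "transpose_mat (U n B) * U n B = 1\<^sub>m k"
proof (rule eq_matI)
  fix a b assume "a < dim_row (1\<^sub>m k :: real mat)" "b < dim_col (1\<^sub>m k :: real mat)"
  then have ab: "a < k" "b < k" by auto
  have len: "length B = k" and dist: "distinct B" using assms by (auto simp: index_vector_def)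
  obtain j where j: "j < n" "B ! a = Suc j" using index_vector_entry[OF assms ab(1)] by auto
  have "(transpose_mat (U n B) * U n B) $$ (a, b)
      = (\<Sum>i\<in>{0..<n}. (if B ! a = Suc i then 1 else 0) * (if B ! b = Suc i then 1 else 0))"
    using ab len by (simp add: U_def scalar_prod_def)
  also have "\<dots> = (\<Sum>i\<in>{0..<n}. if i = j then (if B ! b = Suc j then 1 else 0) else 0)"
    using j by (intro sum.cong) auto
  also have "\<dots> = (if a = b then 1 else 0)"
    using j ab len nth_eq_iff_index_eq[OF dist, of a b] by auto
  finally show "(transpose_mat (U n B) * U n B) $$ (a, b) = (1\<^sub>m k :: real mat) $$ (a, b)"
    using ab by simp
qed (use assms in \<open>auto simp: index_vector_def U_def\<close>)

text \<open>Distinctness of \<open>B\<close> leaves at most one position that writes into row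
  \<open>j\<close>. Thus \<open>U n B\<close> scatters a short vector to the coordinates listed in
  \<open>B\<close>, while its transpose gathers these coordinates.\<close>

lemma U_mult_vec_index:
  assumes "distinct B" "z \<in> carrier_vec (length B)" "j < n"
  shows "a < length B \<Longrightarrow> B ! a = Suc j \<Longrightarrow> (U n B *\<^sub>v z) $ j = z $ a"
    and "Suc j \<notin> set B \<Longrightarrow> (U n B *\<^sub>v z) $ j = 0"
proof -
  have eq: "(U n B *\<^sub>v z) $ j = (\<Sum>i\<in>{0..<length B}. (if B ! i = Suc j then 1 else 0) * z $ i)"
    using assms by (simp add: U_def scalar_prod_def)
  show "(U n B *\<^sub>v z) $ j = z $ a" if a: "a < length B" "B ! a = Suc j"
  proof -
    have "(U n B *\<^sub>v z) $ j = (\<Sum>i\<in>{0..<length B}. if i = a then z $ a else 0)"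
      unfolding eq using a assms(1) by (intro sum.cong) (auto simp: nth_eq_iff_index_eq simp flip: a(2))
    then show ?thesis using a by simp
  qed
  show "(U n B *\<^sub>v z) $ j = 0" if "Suc j \<notin> set B"
    unfolding eq using that nth_mem by (intro sum.neutral) fastforce
qed

lemma U_transpose_mult_vec_index:
  assumes "x \<in> carrier_vec n" "a < length B" "B ! a = Suc j" "j < n"
  shows "(transpose_mat (U n B) *\<^sub>v x) $ a = x $ j"
proof -
  have "(transpose_mat (U n B) *\<^sub>v x) $ a
      = (\<Sum>i\<in>{0..<n}. (if B ! a = Suc i then 1 else 0) * x $ i)"
    using assms by (simp add: U_def scalar_prod_def)
  also have "\<dots> = (\<Sum>i\<in>{0..<n}. if i = j then x $ j else 0)"
    using assms by (intro sum.cong) auto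
  finally show ?thesis using assms by simp
qed

lemma U_mult_U_transpose_vec_index:
  assumes "index_vector n k B" "x \<in> carrier_vec n" "j < n"
  shows "(U n B *\<^sub>v (transpose_mat (U n B) *\<^sub>v x)) $ j = (if Suc j \<in> set B then x $ j else 0)"
proof -
  have B: "distinct B" using assms(1) by (simp add: index_vector_def)
  have c: "transpose_mat (U n B) *\<^sub>v x \<in> carrier_vec (length B)"
    using mult_mat_vec_carrier[OF U_transpose_carrier assms(2)] .
  show ?thesis
  proof (cases "Suc j \<in> set B")
    case True
    then obtain a where "a < length B" "B ! a = Suc j" by (auto simp: in_set_conv_nth)
    with True show ?thesis
      using U_mult_vec_index(1)[OF B c assms(3)] U_transpose_mult_vec_index[OF assms(2) _ _ assms(3)] by simp
  next
    case False
    then show ?thesis using U_mult_vec_index(2)[OF B c assms(3)] by simp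
  qed
qed

section \<open>Algebra of the factors \<open>W n B V\<close>\<close>

lemma W_mult_vec:
  assumes "index_vector n k B" "V \<in> carrier_mat k k" "x \<in> carrier_vec n"
  shows "W n B V *\<^sub>v x
    = x + U n B *\<^sub>v (V *\<^sub>v (transpose_mat (U n B) *\<^sub>v x) - transpose_mat (U n B) *\<^sub>v x)"
proof -
  have len: "length B = k" using assms by (simp add: index_vector_def)
  have U: "U n B \<in> carrier_mat n k" using len U_carrier by blast
  then have Ut: "transpose_mat (U n B) \<in> carrier_mat k n" by simp
  have y: "transpose_mat (U n B) *\<^sub>v x \<in> carrier_vec k" using mult_mat_vec_carrier[OF Ut assms(3)] .
  have VI: "V - 1\<^sub>m k \<in> carrier_mat k k" by (rule minus_carrier_mat) simp
  have UVI: "U n B * (V - 1\<^sub>m k) \<in> carrier_mat n k" using U VI by (rule mult_carrier_mat)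
  have M: "U n B * (V - 1\<^sub>m k) * transpose_mat (U n B) \<in> carrier_mat n n"
    using UVI Ut by (rule mult_carrier_mat)
  have "W n B V *\<^sub>v x = 1\<^sub>m n *\<^sub>v x + U n B * (V - 1\<^sub>m k) * transpose_mat (U n B) *\<^sub>v x"
    unfolding W_def len using M assms(3) by (intro add_mult_distrib_mat_vec) auto
  also have "U n B * (V - 1\<^sub>m k) * transpose_mat (U n B) *\<^sub>v x
      = U n B *\<^sub>v ((V - 1\<^sub>m k) *\<^sub>v (transpose_mat (U n B) *\<^sub>v x))"
    using assoc_mult_mat_vec[OF UVI Ut assms(3)] assoc_mult_mat_vec[OF U VI y] by simp
  also have "(V - 1\<^sub>m k) *\<^sub>v (transpose_mat (U n B) *\<^sub>v x)
      = V *\<^sub>v (transpose_mat (U n B) *\<^sub>v x) - transpose_mat (U n B) *\<^sub>v x"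
    using y assms(2) by (subst minus_mult_distrib_mat_vec[of _ k k]) auto
  finally show ?thesis using assms(3) by simp
qed

text \<open>The correction added to \<open>x\<close> vanishes outside \<open>B\<close>. At an entry
  of \<open>B\<close> its subtracted gathered part cancels \<open>x $ j\<close> and leaves the
  action of \<open>V\<close>.\<close>

lemma W_mult_vec_index:
  assumes B: "index_vector n k B" and V: "V \<in> carrier_mat k k" and x: "x \<in> carrier_vec n" and j: "j < n"
  shows "Suc j \<notin> set B \<Longrightarrow> (W n B V *\<^sub>v x) $ j = x $ j"
    and "a < k \<Longrightarrow> B ! a = Suc j \<Longrightarrow>
      (W n B V *\<^sub>v x) $ j = (V *\<^sub>v (transpose_mat (U n B) *\<^sub>v x)) $ a"
proof -
  have len: "length B = k" and dist: "distinct B" using B by (auto simp: index_vector_def)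
  let ?y = "transpose_mat (U n B) *\<^sub>v x"
  have "?y \<in> carrier_vec (length B)" using mult_mat_vec_carrier[OF U_transpose_carrier x] .
  then have c: "V *\<^sub>v ?y - ?y \<in> carrier_vec (length B)" using V len by auto
  have dU: "dim_vec (U n B *\<^sub>v (V *\<^sub>v ?y - ?y)) = n" by (simp add: U_def)
  show "(W n B V *\<^sub>v x) $ j = x $ j" if "Suc j \<notin> set B"
    using U_mult_vec_index(2)[OF dist c j that] x j dU by (simp add: W_mult_vec[OF B V x])
  show "(W n B V *\<^sub>v x) $ j = (V *\<^sub>v ?y) $ a" if a: "a < k" "B ! a = Suc j"
  proof -
    have al: "a < length B" using a len by simp
    have "(W n B V *\<^sub>v x) $ j = x $ j + (V *\<^sub>v ?y - ?y) $ a"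
      using U_mult_vec_index(1)[OF dist c j al a(2)] x j dU by (simp add: W_mult_vec[OF B V x])
    moreover have "(V *\<^sub>v ?y - ?y) $ a = (V *\<^sub>v ?y) $ a - ?y $ a"
      using al by (simp add: U_def)
    ultimately show ?thesis
      using U_transpose_mult_vec_index[OF x al a(2) j] by simp
  qed
qed

text \<open>The entrywise formula applies at every listed coordinate. This intertwining relation
  lets compositions of factors be followed on the \<open>k\<close> gathered coordinates
  alone.\<close>

lemma U_transpose_W_mult_vec:
  assumes B: "index_vector n k B" and V: "V \<in> carrier_mat k k" and x: "x \<in> carrier_vec n"
  shows "transpose_mat (U n B) *\<^sub>v (W n B V *\<^sub>v x) = V *\<^sub>v (transpose_mat (U n B) *\<^sub>v x)"
proof (rule eq_vecI)
  have len: "length B = k" using B by (auto simp: index_vector_def)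
  have Wx: "W n B V *\<^sub>v x \<in> carrier_vec n"
    using mult_mat_vec_carrier[OF W_carrier x] V len by blast
  fix a assume "a < dim_vec (V *\<^sub>v (transpose_mat (U n B) *\<^sub>v x))"
  then have a: "a < k" using V by simp
  obtain j where j: "j < n" "B ! a = Suc j" using index_vector_entry[OF B a] by auto
  show "(transpose_mat (U n B) *\<^sub>v (W n B V *\<^sub>v x)) $ a
      = (V *\<^sub>v (transpose_mat (U n B) *\<^sub>v x)) $ a"
    using U_transpose_mult_vec_index[OF Wx, of a B j] W_mult_vec_index(2)[OF B V x j(1) a j(2)] a j len
    by simp
qed (use B V in \<open>auto simp: index_vector_def U_def\<close>)

text \<open>Both factors leave the coordinates outside \<open>B\<close> alone, and on
  \<open>B\<close> the intertwining relation turns composition into the product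
  \<open>V * V'\<close>.\<close>

lemma W_mult:
  assumes B: "index_vector n k B" and V: "V \<in> carrier_mat k k" and V': "V' \<in> carrier_mat k k"
  shows "W n B V * W n B V' = W n B (V * V')"
proof (rule mat_vec_eqI)
  have len: "length B = k" using B by (auto simp: index_vector_def)
  have VV: "V * V' \<in> carrier_mat k k" using V V' by simp
  have W: "W n B V \<in> carrier_mat n n" "W n B V' \<in> carrier_mat n n" "W n B (V * V') \<in> carrier_mat n n"
    using V V' VV len by auto
  then show "W n B V * W n B V' \<in> carrier_mat n n" "W n B (V * V') \<in> carrier_mat n n" by auto
  fix x :: "real vec" assume x: "x \<in> carrier_vec n"
  let ?x = "W n B V' *\<^sub>v x"
  have x': "?x \<in> carrier_vec n" using W x by auto
  have y: "transpose_mat (U n B) *\<^sub>v x \<in> carrier_vec k" using mult_mat_vec_carrier[OF U_transpose_carrier x] len by blast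
  have "W n B V * W n B V' *\<^sub>v x = W n B V *\<^sub>v ?x" using W x by (intro assoc_mult_mat_vec)
  also have "\<dots> = W n B (V * V') *\<^sub>v x"
  proof (rule eq_vecI)
    fix j assume "j < dim_vec (W n B (V * V') *\<^sub>v x)"
    then have j: "j < n" using W by simp
    show "(W n B V *\<^sub>v ?x) $ j = (W n B (V * V') *\<^sub>v x) $ j"
    proof (cases "Suc j \<in> set B")
      case True
      then obtain a where a: "a < k" "B ! a = Suc j" using len by (auto simp: in_set_conv_nth)
      show ?thesis
        using W_mult_vec_index(2)[OF B V x' j a] W_mult_vec_index(2)[OF B VV x j a]
          U_transpose_W_mult_vec[OF B V' x] assoc_mult_mat_vec[OF V V' y] by simp
    next
      case False
      then show ?thesis
        using W_mult_vec_index(1)[OF B V x' j] W_mult_vec_index(1)[OF B V' x j]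
          W_mult_vec_index(1)[OF B VV x j] by simp
    qed
  qed (use W in auto)
  finally show "W n B V * W n B V' *\<^sub>v x = W n B (V * V') *\<^sub>v x" .
qed

lemma W_one: "W n B (1\<^sub>m (length B)) = 1\<^sub>m n"
  unfolding W_def
  by (simp add: minus_r_inv_mat[OF one_carrier_mat] right_mult_zero_mat[OF U_carrier]
      left_mult_zero_mat[OF U_transpose_carrier])

lemma W_transpose:
  assumes "index_vector n k B" "V \<in> carrier_mat k k"
  shows "transpose_mat (W n B V) = W n B (transpose_mat V)"
proof -
  have len: "length B = k" using assms by (simp add: index_vector_def)
  have U: "U n B \<in> carrier_mat n k" using len U_carrier by blast
  then have Ut: "transpose_mat (U n B) \<in> carrier_mat k n" by simp
  have VI: "V - 1\<^sub>m k \<in> carrier_mat k k" by (rule minus_carrier_mat) simp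
  have VIt: "transpose_mat (V - 1\<^sub>m k) = transpose_mat V - 1\<^sub>m k"
    using assms(2) by (simp add: transpose_minus)
  have VtI: "transpose_mat V - 1\<^sub>m k \<in> carrier_mat k k" by (rule minus_carrier_mat) simp
  have UV: "U n B * (V - 1\<^sub>m k) \<in> carrier_mat n k" using U VI by (rule mult_carrier_mat)
  have "transpose_mat (U n B * (V - 1\<^sub>m k) * transpose_mat (U n B))
      = U n B * (transpose_mat V - 1\<^sub>m k) * transpose_mat (U n B)"
    using transpose_mult[OF UV Ut] transpose_mult[OF U VI] VIt
      assoc_mult_mat[OF U VtI Ut] by simp
  then show ?thesis
    unfolding W_def len using transpose_add[OF one_carrier_mat mult_carrier_mat[OF UV Ut]] by simp
qed

text \<open>Forming the factor respects products, transposes and the identity, so orthogonality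
  passes from \<open>V\<close> to it.\<close>

lemma W_in_St:
  assumes "index_vector n k B" "V \<in> St k k"
  shows "W n B V \<in> St n n"
proof -
  have V: "V \<in> carrier_mat k k" "transpose_mat V * V = 1\<^sub>m k" and len: "length B = k"
    using assms by (auto simp: St_def index_vector_def)
  then have "transpose_mat (W n B V) * W n B V = 1\<^sub>m n"
    using W_transpose[OF assms(1) V(1)] W_mult[OF assms(1) _ V(1), of "transpose_mat V"]
      W_one[of n B] by simp
  then show ?thesis using V len by (auto simp: St_def)
qed

lemma U_mult_U_transpose:
  assumes "index_vector n k B"
  shows "U n B * transpose_mat (U n B) = mat n n (\<lambda>(i, j). if i = j \<and> Suc i \<in> set B then 1 else 0)"
proof (rule eq_matI)
  fix i j
  assume "i < dim_row (mat n n (\<lambda>(i, j). if i = j \<and> Suc i \<in> set B then 1 else (0 :: real)))"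
    and "j < dim_col (mat n n (\<lambda>(i, j). if i = j \<and> Suc i \<in> set B then 1 else (0 :: real)))"
  then have ij: "i < n" "j < n" by auto
  have "(U n B * transpose_mat (U n B)) $$ (i, j)
      = (U n B *\<^sub>v (transpose_mat (U n B) *\<^sub>v unit_vec n j)) $ i"
    using ij mult_mat_unit_vec[OF U_transpose_carrier, of j n B] by simp
  also have "\<dots> = (if i = j \<and> Suc i \<in> set B then 1 else 0)"
    using U_mult_U_transpose_vec_index[OF assms, of "unit_vec n j" i] ij by auto
  finally show "(U n B * transpose_mat (U n B)) $$ (i, j)
      = mat n n (\<lambda>(i, j). if i = j \<and> Suc i \<in> set B then 1 else 0) $$ (i, j)"
    using ij by simp
qed (auto simp: U_def)

lemma W_expand:
  assumes "index_vector n k B" "V \<in> carrier_mat k k"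
  shows "W n B V = 1\<^sub>m n - U n B * transpose_mat (U n B) + U n B * V * transpose_mat (U n B)"
proof -
  have len: "length B = k" using assms by (simp add: index_vector_def)
  have U: "U n B \<in> carrier_mat n k" using len U_carrier by blast
  then have Ut: "transpose_mat (U n B) \<in> carrier_mat k n" by simp
  have UV: "U n B * V \<in> carrier_mat n k" using U assms(2) by (rule mult_carrier_mat)
  have c: "U n B * transpose_mat (U n B) \<in> carrier_mat n n"
    "U n B * V * transpose_mat (U n B) \<in> carrier_mat n n"
    using U Ut UV by auto
  have "U n B * (V - 1\<^sub>m k) * transpose_mat (U n B) = (U n B * V - U n B * 1\<^sub>m k) * transpose_mat (U n B)"
    using mult_minus_distrib_mat[OF U assms(2) one_carrier_mat] by simp
  also have "\<dots> = U n B * V * transpose_mat (U n B) - U n B * transpose_mat (U n B)"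
    unfolding right_mult_one_mat[OF U] by (rule minus_mult_distrib_mat[OF UV U Ut])
  finally show ?thesis
    unfolding W_def len using c by (intro eq_matI) auto
qed

text \<open>The matrix \<open>1\<^sub>m n - U n B * transpose_mat (U n B)\<close> projects onto the
  coordinates outside \<open>B\<close>, which are exactly those of \<open>Bc\<close>.\<close>

lemma W_eq_complement:
  assumes B: "index_vector n k B" and V: "V \<in> carrier_mat k k" and Bc: "complementary n B Bc"
  shows "W n B V = U n B * V * transpose_mat (U n B) + U n Bc * transpose_mat (U n Bc)"
proof -
  have Bc': "index_vector n (length Bc) Bc" using Bc by (auto simp: complementary_def index_vector_def)
  have "1\<^sub>m n - U n B * transpose_mat (U n B) = U n Bc * transpose_mat (U n Bc)"
    unfolding U_mult_U_transpose[OF B] U_mult_U_transpose[OF Bc']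
    using Bc by (intro eq_matI) (auto simp: complementary_def)
  moreover have "U n B * V * transpose_mat (U n B) + M = M + U n B * V * transpose_mat (U n B)"
    if "M \<in> carrier_mat n n" for M
    using B V that by (intro comm_add_mat[of _ n n]) (auto simp: index_vector_def U_def intro!: mult_carrier_mat)
  moreover have "U n Bc * transpose_mat (U n Bc) \<in> carrier_mat n n"
    by (rule mult_carrier_mat[OF U_carrier U_transpose_carrier])
  ultimately show ?thesis using W_expand[OF B V] by simp
qed

text \<open>Every \<open>y\<close> is gathered back from \<open>U n B *\<^sub>v y\<close>, where the
  factor reveals the action of \<open>V\<close>. This serves to recover orthogonality of
  \<open>V\<close> from that of its factor.\<close>

lemma W_inject:
  assumes B: "index_vector n k B" and V: "V \<in> carrier_mat k k" and V': "V' \<in> carrier_mat k k"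
    and eq: "W n B V = W n B V'"
  shows "V = V'"
proof (rule mat_vec_eqI[OF V V'])
  fix y :: "real vec" assume y: "y \<in> carrier_vec k"
  have U: "U n B \<in> carrier_mat n k" using B U_carrier by (auto simp: index_vector_def)
  then have Ut: "transpose_mat (U n B) \<in> carrier_mat k n" by simp
  have x: "U n B *\<^sub>v y \<in> carrier_vec n" using mult_mat_vec_carrier[OF U y] .
  have "transpose_mat (U n B) *\<^sub>v (U n B *\<^sub>v y) = y"
    using assoc_mult_mat_vec[OF Ut U y] U_transpose_mult_U[OF B] y by simp
  then show "V *\<^sub>v y = V' *\<^sub>v y"
    using U_transpose_W_mult_vec[OF B V x] U_transpose_W_mult_vec[OF B V' x] eq by simp
qed

section \<open>Orthogonal matrices with unit rows\<close>

lemma St_col_unit_of_row_unit: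
  assumes E: "E \<in> St n n" and p: "p < n" and row: "row E p = unit_vec n p"
  shows "col E p = unit_vec n p"
proof -
  have c: "E \<in> carrier_mat n n" "transpose_mat E \<in> carrier_mat n n" using St_carrier[OF E] by auto
  \<comment> \<open>The transpose sends the unit vector to row \<open>p\<close>, so the hypothesis
    makes it a fixed vector; \<open>E\<close> inverts the transpose and therefore fixes it
    too.\<close>
  have e: "transpose_mat E *\<^sub>v unit_vec n p = unit_vec n p"
    using mult_mat_unit_vec[OF c(2) p] row p c(1) by simp
  have "col E p = E *\<^sub>v (transpose_mat E *\<^sub>v unit_vec n p)"
    unfolding e using mult_mat_unit_vec[OF c(1) p] by simp
  also have "\<dots> = (E * transpose_mat E) *\<^sub>v unit_vec n p"
    using assoc_mult_mat_vec[OF c unit_vec_carrier] by simp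
  finally show ?thesis using St_square_transpose[OF E] by simp
qed

text \<open>Strong induction on the row: earlier unit rows force unit columns and so clear the
  entries left of the diagonal, the hypothesis clears those on the right, and the length of the row
  fixes the remaining entry up to sign.\<close>

lemma St_rows_unit_of_upper_zero:
  assumes E: "E \<in> St n n" and "q \<le> n"
    and nonneg: "\<And>p. p < q \<Longrightarrow> 0 \<le> E $$ (p, p)"
    and zero: "\<And>p j. p < q \<Longrightarrow> p < j \<Longrightarrow> j < n \<Longrightarrow> E $$ (p, j) = 0"
  shows "p < q \<Longrightarrow> row E p = unit_vec n p"
proof (induction p rule: less_induct)
  case (less p)
  have c: "E \<in> carrier_mat n n" using St_carrier[OF E] .
  have p: "p < n" using less.prems assms(2) by simp
  have off: "E $$ (p, j) = 0" if "j < n" "j \<noteq> p" for j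
  proof (cases "j < p")
    case True
    then have "col E j = unit_vec n j"
      using St_col_unit_of_row_unit[OF E, of j] less that by simp
    then have "col E j $ p = 0" using p that by simp
    then show ?thesis using c p that by simp
  next
    case False
    then show ?thesis using zero less.prems that by simp
  qed
  have row: "row E p = E $$ (p, p) \<cdot>\<^sub>v unit_vec n p"
    using c p off by (intro eq_vecI) auto
  have "row E p \<bullet> row E p = (E * transpose_mat E) $$ (p, p)"
    using c p by simp
  also have "\<dots> = 1" using St_square_transpose[OF E] p by simp
  finally have "E $$ (p, p) * E $$ (p, p) = 1"
    unfolding row using p by simp
  \<comment> \<open>Nonnegativity excludes the root \<open>-1\<close>.\<close>
  then have "E $$ (p, p) = 1"
    using nonneg[OF less.prems] by (simp add: square_eq_1_iff)
  then show ?case using row by simp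
qed

text \<open>Unit rows outside \<open>B\<close> force unit columns there, so \<open>E\<close> is the
  identity apart from its block on \<open>B\<close>. That block is \<open>V\<close>.\<close>

lemma St_eq_W:
  assumes E: "E \<in> St n n" and B: "index_vector n k B"
    and rows: "\<And>j. j < n \<Longrightarrow> Suc j \<notin> set B \<Longrightarrow> row E j = unit_vec n j"
  shows "\<exists>V\<in>St k k. E = W n B V"
proof -
  have len: "length B = k" using B by (simp add: index_vector_def)
  have U: "U n B \<in> carrier_mat n k" using len U_carrier by blast
  then have Ut: "transpose_mat (U n B) \<in> carrier_mat k n" by simp
  have c: "E \<in> carrier_mat n n" using St_carrier[OF E] .
  \<comment> \<open>The submatrix of \<open>E\<close> with rows and columns taken from
    \<open>B\<close>.\<close>
  let ?V = "transpose_mat (U n B) * (E * U n B)"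
  have EU: "E * U n B \<in> carrier_mat n k" using c U by (rule mult_carrier_mat)
  have V: "?V \<in> carrier_mat k k" using Ut EU by (rule mult_carrier_mat)
  have W: "W n B ?V \<in> carrier_mat n n" using W_carrier V len by simp
  have eq: "E = W n B ?V"
  proof (rule mat_vec_eqI[OF c W])
    fix x :: "real vec" assume x: "x \<in> carrier_vec n"
    let ?y = "transpose_mat (U n B) *\<^sub>v x"
    let ?Px = "U n B *\<^sub>v ?y"
    have y: "?y \<in> carrier_vec k" using mult_mat_vec_carrier[OF Ut x] .
    have Px: "?Px \<in> carrier_vec n" using mult_mat_vec_carrier[OF U y] .
    have EPx: "E *\<^sub>v ?Px \<in> carrier_vec n" using mult_mat_vec_carrier[OF c Px] .
    have Vy: "?V *\<^sub>v ?y = transpose_mat (U n B) *\<^sub>v (E *\<^sub>v ?Px)"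
      using assoc_mult_mat_vec[OF Ut EU y] assoc_mult_mat_vec[OF c U y] by simp
    show "E *\<^sub>v x = W n B ?V *\<^sub>v x"
    proof (rule eq_vecI)
      fix j assume "j < dim_vec (W n B ?V *\<^sub>v x)"
      then have j: "j < n" using W by simp
      show "(E *\<^sub>v x) $ j = (W n B ?V *\<^sub>v x) $ j"
      proof (cases "Suc j \<in> set B")
        case True
        then obtain a where a: "a < k" "B ! a = Suc j" using len by (auto simp: in_set_conv_nth)
        have "(W n B ?V *\<^sub>v x) $ j = (E *\<^sub>v ?Px) $ j"
          using W_mult_vec_index(2)[OF B V x j a] Vy a len
            U_transpose_mult_vec_index[OF EPx _ _ j, of a B] by simp
        also have "\<dots> = (\<Sum>i\<in>{0..<n}. E $$ (j, i) * ?Px $ i)"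
          using c j Px by (simp add: scalar_prod_def)
        \<comment> \<open>Replacing the projection of \<open>x\<close> by \<open>x\<close> is
          harmless: for \<open>i\<close> outside \<open>B\<close>, column \<open>i\<close> of
          \<open>E\<close> is a unit vector with its 1 in a row other than \<open>j\<close>.\<close>
        also have "\<dots> = (\<Sum>i\<in>{0..<n}. E $$ (j, i) * x $ i)"
        proof (rule sum.cong)
          fix i assume "i \<in> {0..<n}"
          then have i: "i < n" by simp
          show "E $$ (j, i) * ?Px $ i = E $$ (j, i) * x $ i"
          proof (cases "Suc i \<in> set B")
            case True
            then show ?thesis using U_mult_U_transpose_vec_index[OF B x i] by simp
          next
            case False
            then have "col E i = unit_vec n i"
              using St_col_unit_of_row_unit[OF E i] rows[OF i] by simp
            moreover have "j \<noteq> i" using False \<open>Suc j \<in> set B\<close> by auto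
            ultimately have "col E i $ j = 0" using i j by simp
            then show ?thesis using c i j by simp
          qed
        qed simp
        also have "\<dots> = (E *\<^sub>v x) $ j"
          using c j x by (simp add: scalar_prod_def)
        finally show ?thesis by simp
      next
        case False
        then show ?thesis
          using W_mult_vec_index(1)[OF B V x j] rows[OF j] c j x by simp
      qed
    qed (use c W in auto)
  qed
  have Vt: "transpose_mat ?V \<in> carrier_mat k k" using V by simp
  have VtV: "transpose_mat ?V * ?V \<in> carrier_mat k k" using Vt V by (rule mult_carrier_mat)
  \<comment> \<open>Orthogonality of \<open>E\<close> is pulled back to \<open>?V\<close> by
    multiplicativity and injectivity of the factor.\<close>
  have "W n B (transpose_mat ?V * ?V) = transpose_mat E * E"
    using W_mult[OF B Vt V] W_transpose[OF B V] eq by metis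
  also have "\<dots> = W n B (1\<^sub>m k)"
    using E W_one[of n B] len by (simp add: St_def)
  finally have "transpose_mat ?V * ?V = 1\<^sub>m k"
    using W_inject[OF B VtV] by simp
  then show ?thesis using V eq by (auto simp: St_def)
qed

section \<open>Elimination by a reflection on one subset\<close>

lemma W_reflection_exists:
  assumes B: "index_vector n k B" and p: "p < n" "Suc p \<in> set B" and x: "x \<in> carrier_vec n"
  shows "\<exists>A\<in>St k k. transpose_mat A = A \<and> 0 \<le> (W n B A *\<^sub>v x) $ p \<and>
    (\<forall>j<n. Suc j \<in> set B \<longrightarrow> j \<noteq> p \<longrightarrow> (W n B A *\<^sub>v x) $ j = 0)"
proof -
  have len: "length B = k" using B by (simp add: index_vector_def)
  obtain a where a: "a < k" "B ! a = Suc p" using p len by (auto simp: in_set_conv_nth)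
  let ?y = "transpose_mat (U n B) *\<^sub>v x"
  have y: "?y \<in> carrier_vec k" using mult_mat_vec_carrier[OF U_transpose_carrier x, of B] len by simp
  \<comment> \<open>The target has the length of the gathered vector and points along position
    \<open>a\<close>, which holds the coordinate \<open>p\<close>; the nonnegative root settles the
    sign.\<close>
  let ?z = "sqrt (?y \<bullet> ?y) \<cdot>\<^sub>v unit_vec k a"
  have z: "?z \<in> carrier_vec k" by simp
  have yy: "0 \<le> ?y \<bullet> ?y" unfolding scalar_prod_def by (intro sum_nonneg) simp
  have "?y \<bullet> ?y = ?z \<bullet> ?z" using yy a by simp
  let ?A = "householder k (?y - ?z)"
  have A: "?A \<in> St k k" using y z by (intro householder_in_St) auto
  have Ay: "?A *\<^sub>v ?y = ?z" by (rule householder_reflects[OF y z]) fact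
  have idx: "(W n B ?A *\<^sub>v x) $ j = ?z $ b" if "j < n" "b < k" "B ! b = Suc j" for j b
    using W_mult_vec_index(2)[OF B householder_carrier x that] Ay by simp
  have "0 \<le> (W n B ?A *\<^sub>v x) $ p" using idx[OF p(1) a] a yy by simp
  moreover have "(W n B ?A *\<^sub>v x) $ j = 0" if j: "j < n" "Suc j \<in> set B" "j \<noteq> p" for j
  proof -
    obtain b where b: "b < k" "B ! b = Suc j" using j len by (auto simp: in_set_conv_nth)
    then have "b \<noteq> a" using a j by auto
    then show ?thesis using idx[OF j(1) b] a b by simp
  qed
  ultimately show ?thesis using A householder_transpose by blast
qed

text \<open>Transfers the elimination from a single vector to a row of \<open>E\<close>, since the
  factors split off \<open>D\<close> multiply \<open>E\<close> from the right.\<close>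

lemma row_mult_eq_transpose_mult_vec:
  assumes "E \<in> carrier_mat n m" "M \<in> carrier_mat m l" "p < n"
  shows "row (E * M) p = transpose_mat M *\<^sub>v (row E p :: 'a :: comm_semiring_0 vec)"
proof (rule eq_vecI)
  fix j assume "j < dim_vec (transpose_mat M *\<^sub>v row E p)"
  then have "j < l" using assms by simp
  then show "row (E * M) p $ j = (transpose_mat M *\<^sub>v row E p) $ j"
    using assms comm_scalar_prod[of "row E p" m "col M j"] by simp
qed (use assms in auto)

text \<open>Nothing of this unit vector is gathered, since its coordinate is outside
  \<open>B\<close>. Finished rows thus survive later factors.\<close>

lemma W_mult_unit_vec:
  assumes B: "index_vector n k B" and V: "V \<in> carrier_mat k k" and q: "q < n" "Suc q \<notin> set B"
  shows "W n B V *\<^sub>v unit_vec n q = unit_vec n q"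
proof -
  have len: "length B = k" using B by (simp add: index_vector_def)
  have "(transpose_mat (U n B) *\<^sub>v unit_vec n q) = 0\<^sub>v k"
  proof (rule eq_vecI)
    fix a assume "a < dim_vec (0\<^sub>v k :: real vec)"
    then have a: "a < k" by simp
    obtain j where j: "j < n" "B ! a = Suc j" using index_vector_entry[OF B a] .
    then have "j \<noteq> q" using q a len nth_mem[of a B] by auto
    then show "(transpose_mat (U n B) *\<^sub>v unit_vec n q) $ a = 0\<^sub>v k $ a"
      using U_transpose_mult_vec_index[of "unit_vec n q" n a B j] j a len q by simp
  qed (use len in simp)
  moreover have "V *\<^sub>v 0\<^sub>v k - 0\<^sub>v k = 0\<^sub>v k" using V by auto
  moreover have "U n B *\<^sub>v 0\<^sub>v k = 0\<^sub>v n" using len by (intro eq_vecI) auto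
  ultimately show ?thesis using W_mult_vec[OF B V unit_vec_carrier, of q] by simp
qed

lemma W_prod_cong:
  assumes "\<And>i. i \<in> {1..m} \<Longrightarrow> V i = V' i"
  shows "W_prod n B V m = W_prod n B V' m"
  using assms by (induction m) auto

lemma W_prod_carrier:
  assumes "\<And>i. i \<in> {1..m} \<Longrightarrow> index_vector n k (B i)" "\<And>i. V i \<in> carrier_mat k k"
  shows "W_prod n B V m \<in> carrier_mat n n"
  using assms(1)
proof (induction m)
  case (Suc m)
  then have "length (B (Suc m)) = k" by (auto simp: index_vector_def)
  then have "W n (B (Suc m)) (V (Suc m)) \<in> carrier_mat n n"
    using assms(2) by (intro W_carrier) simp
  then show ?case using Suc by (auto intro: mult_carrier_mat)
qed simp

lemma W_prod_one:
  assumes "\<And>i. i \<in> {1..m} \<Longrightarrow> length (B i) = k \<and> V i = 1\<^sub>m k"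
  shows "W_prod n B V m = 1\<^sub>m n"
  using assms
proof (induction m)
  case (Suc m)
  then show ?case using W_one[of n "B (Suc m)"] by simp
qed simp

section \<open>Elimination along a list of subsets with nondecreasing minima\<close>

lemma index_vector_Min:
  assumes B: "index_vector n k B" and k: "1 \<le> k"
  obtains p where "Min (set B) = Suc p" "Suc p \<in> set B" "p + k \<le> n" "set B \<subseteq> {Suc p..n}"
proof -
  have fin: "finite (set B)" "set B \<noteq> {}" "set B \<subseteq> {1..n}" "card (set B) = k"
    using B k by (auto simp: index_vector_def distinct_card)
  have mem: "Min (set B) \<in> set B" using fin by simp
  then have "Min (set B) \<in> {1..n}" using fin(3) by blast
  then obtain p where p: "Min (set B) = Suc p" by (cases "Min (set B)") auto
  have sub: "set B \<subseteq> {Suc p..n}"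
    using fin(3) Min_le[OF fin(1)] p by fastforce
  \<comment> \<open>The \<open>k\<close> elements of \<open>B\<close> lie among the
    \<open>n - p\<close> numbers from \<open>Suc p\<close> to \<open>n\<close>.\<close>
  then have "k \<le> card {Suc p..n}" using card_mono[OF _ sub] fin(4) by simp
  then have "p + k \<le> n" using k by simp
  then show ?thesis using that p mem sub by simp
qed

text \<open>Collects what the elimination uses of the listing. By \<open>mono\<close> the rows are
  finished from top to bottom. In the rows \<open>p\<close> with \<open>p + k \<le> n\<close>,
  \<open>cover\<close> supplies a subset clearing each entry right of the diagonal, and
  \<open>nonempty\<close> one that fixes the sign on the diagonal. Row \<open>p\<close> belongs to
  the minimum \<open>Suc p\<close> because rows are 0-based.\<close>

locale covering_by_minima =
  fixes n k N :: nat and B :: "nat \<Rightarrow> nat list"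
  assumes k: "1 \<le> k"
    and index: "\<And>i. i \<in> {1..N} \<Longrightarrow> index_vector n k (B i)"
    and mono: "\<And>i j. 1 \<le> i \<Longrightarrow> i \<le> j \<Longrightarrow> j \<le> N \<Longrightarrow> Min (set (B i)) \<le> Min (set (B j))"
    and cover: "\<And>p j. p + k \<le> n \<Longrightarrow> p < j \<Longrightarrow> j < n \<Longrightarrow>
      \<exists>i\<in>{1..N}. Min (set (B i)) = Suc p \<and> Suc j \<in> set (B i)"
    and nonempty: "\<And>p. p + k \<le> n \<Longrightarrow> \<exists>i\<in>{1..N}. Min (set (B i)) = Suc p"
begin

text \<open>The elimination invariant after \<open>m\<close> subsets. It speaks only of entries that
  these subsets reach in the rows of their minima, since the current row may still be in
  progress.\<close>

definition reduced :: "nat \<Rightarrow> real mat \<Rightarrow> bool" where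
  "reduced m E \<longleftrightarrow> (\<forall>i\<in>{1..m}. \<forall>p. Min (set (B i)) = Suc p \<longrightarrow>
     0 \<le> E $$ (p, p) \<and> (\<forall>j<n. Suc j \<in> set (B i) \<longrightarrow> j \<noteq> p \<longrightarrow> E $$ (p, j) = 0))"

text \<open>Once all subsets belonging to rows above \<open>q\<close> are used, \<open>cover\<close>
  and \<open>nonempty\<close> turn the invariant into the triangular shape with nonnegative diagonal
  that forces unit rows.\<close>

lemma reduced_rows_unit:
  assumes E: "E \<in> St n n" and red: "reduced m E" and q: "q \<le> n" "\<And>p. p < q \<Longrightarrow> p + k \<le> n"
    and past: "\<And>i p. i \<in> {1..N} \<Longrightarrow> p < q \<Longrightarrow> Min (set (B i)) = Suc p \<Longrightarrow> i \<le> m"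
    and p: "p < q"
  shows "row E p = unit_vec n p"
proof (rule St_rows_unit_of_upper_zero[OF E q(1) _ _ p])
  fix p assume p: "p < q"
  obtain i where i: "i \<in> {1..N}" "Min (set (B i)) = Suc p" using nonempty[OF q(2)[OF p]] by auto
  then have "i \<in> {1..m}" using past[OF i(1) p] by simp
  then show "0 \<le> E $$ (p, p)" using red i unfolding reduced_def by blast
next
  fix p j assume p: "p < q" and j: "p < j" "j < n"
  obtain i where i: "i \<in> {1..N}" "Min (set (B i)) = Suc p" "Suc j \<in> set (B i)"
    using cover[OF q(2)[OF p] j] by auto
  then have "i \<in> {1..m}" using past[OF i(1) p] by simp
  then show "E $$ (p, j) = 0" using red i j unfolding reduced_def by fastforce
qed

lemma reduced_step:
  assumes E: "E \<in> St n n" and red: "reduced m E" and m: "Suc m \<le> N"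
  shows "\<exists>A\<in>St k k. transpose_mat A = A \<and> reduced (Suc m) (E * W n (B (Suc m)) A)"
proof -
  let ?B = "B (Suc m)"
  have B: "index_vector n k ?B" using index m by simp
  obtain p where p: "Min (set ?B) = Suc p" "Suc p \<in> set ?B" "p + k \<le> n" "set ?B \<subseteq> {Suc p..n}"
    using index_vector_Min[OF B k] .
  have pn: "p < n" using p k by simp
  have c: "E \<in> carrier_mat n n" using St_carrier[OF E] .
  \<comment> \<open>By \<open>mono\<close>, every subset with a smaller minimum precedes this one,
    so the rows above \<open>p\<close> are finished.\<close>
  have rows: "row E q = unit_vec n q" if "q < p" for q
  proof (rule reduced_rows_unit[OF E red _ _ _ that])
    fix i q assume i: "i \<in> {1..N}" "q < p" "Min (set (B i)) = Suc q"
    show "i \<le> m"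
    proof (rule ccontr)
      assume "\<not> i \<le> m"
      then have "Min (set ?B) \<le> Min (set (B i))" using i m by (intro mono) auto
      then show False using i p by simp
    qed
  qed (use p pn in auto)
  have x: "row E p \<in> carrier_vec n" using c by auto
  obtain A where A: "A \<in> St k k" "transpose_mat A = A" "0 \<le> (W n ?B A *\<^sub>v row E p) $ p"
    "\<And>j. j < n \<Longrightarrow> Suc j \<in> set ?B \<Longrightarrow> j \<noteq> p \<Longrightarrow> (W n ?B A *\<^sub>v row E p) $ j = 0"
    using W_reflection_exists[OF B pn p(2) x] by auto
  have Ac: "A \<in> carrier_mat k k" using St_carrier[OF A(1)] .
  let ?W = "W n ?B A"
  have Wc: "?W \<in> carrier_mat n n" using B Ac by (auto simp: index_vector_def)
  \<comment> \<open>Symmetry makes right multiplication by \<open>?W\<close> act on each row by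
    \<open>?W\<close> itself.\<close>
  have Wt: "transpose_mat ?W = ?W" using W_transpose[OF B Ac] A(2) by simp
  have row: "row (E * ?W) q = ?W *\<^sub>v row E q" if "q < n" for q
    using row_mult_eq_transpose_mult_vec[OF c Wc that] Wt by simp
  have ent: "(E * ?W) $$ (q, j) = (?W *\<^sub>v row E q) $ j" if "q < n" "j < n" for q j
  proof -
    have "(E * ?W) $$ (q, j) = row (E * ?W) q $ j" using that c Wc by simp
    then show ?thesis using row[OF that(1)] by simp
  qed
  have "reduced (Suc m) (E * ?W)"
    unfolding reduced_def
  proof (intro ballI allI impI)
    fix i q assume i: "i \<in> {1..Suc m}" and q: "Min (set (B i)) = Suc q"
    have "Min (set (B i)) \<le> Min (set ?B)" using i m by (intro mono) auto
    then have "q \<le> p" using q p by simp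
    show "0 \<le> (E * ?W) $$ (q, q) \<and>
      (\<forall>j<n. Suc j \<in> set (B i) \<longrightarrow> j \<noteq> q \<longrightarrow> (E * ?W) $$ (q, j) = 0)"
    proof (cases "q = p")
      case True
      \<comment> \<open>Entries inside \<open>?B\<close> are cleared by the choice of
        \<open>A\<close>. An entry outside \<open>?B\<close> must come from an earlier subset, and
        its zero is left untouched.\<close>
      have "(E * ?W) $$ (p, j) = 0" if j: "j < n" "Suc j \<in> set (B i)" "j \<noteq> p" for j
      proof (cases "Suc j \<in> set ?B")
        case True
        then show ?thesis using A(4) j ent[OF pn] by simp
      next
        case False
        then have "i \<in> {1..m}" using i j by (cases "i = Suc m") auto
        then have "E $$ (p, j) = 0" using red q j \<open>q = p\<close> unfolding reduced_def by blast
        then show ?thesis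
          using ent[OF pn j(1)] W_mult_vec_index(1)[OF B Ac x j(1) False] c pn j by simp
      qed
      then show ?thesis using True A(3) ent[OF pn pn] by simp
    next
      case False
      then have "q < p" using \<open>q \<le> p\<close> by simp
      then have qn: "q < n" "Suc q \<notin> set ?B" using pn p(4) by auto
      \<comment> \<open>Row \<open>q\<close> is already a unit vector, and its coordinate lies below
        the minimum of \<open>?B\<close>, so the factor fixes it.\<close>
      have "?W *\<^sub>v row E q = unit_vec n q"
        using rows[OF \<open>q < p\<close>] W_mult_unit_vec[OF B Ac qn] by simp
      then show ?thesis using ent[OF qn(1)] qn by simp
    qed
  qed
  with A show ?thesis by blast
qed

text \<open>Each step inserts \<open>?W * ?W\<close>, which is the identity, between the remainder
  and the product: one copy reduces the remainder, the other becomes the new leftmost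
  factor.\<close>

lemma W_prod_factor:
  assumes D: "D \<in> St n n" and "m \<le> N"
  shows "\<exists>V E. (\<forall>i. V i \<in> St k k) \<and> E \<in> St n n \<and> D = E * W_prod n B V m \<and> reduced m E"
  using assms(2)
proof (induction m)
  case 0
  have "D = D * W_prod n B (\<lambda>_. 1\<^sub>m k) 0" using St_carrier[OF D] by simp
  moreover have "reduced 0 D" by (simp add: reduced_def)
  ultimately show ?case
    using D one_in_St[of k] by (intro exI[of _ "\<lambda>_. 1\<^sub>m k"] exI[of _ D]) simp
next
  case (Suc m)
  then obtain V E where V: "\<And>i. V i \<in> St k k" and E: "E \<in> St n n"
    and D: "D = E * W_prod n B V m" and red: "reduced m E" by auto
  let ?B = "B (Suc m)"
  have B: "index_vector n k ?B" using index Suc.prems by simp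
  obtain A where A: "A \<in> St k k" "transpose_mat A = A" "reduced (Suc m) (E * W n ?B A)"
    using reduced_step[OF E red Suc.prems] by auto
  let ?W = "W n ?B A" and ?V = "V(Suc m := A)" and ?P = "W_prod n B V m"
  have Ac: "A \<in> carrier_mat k k" using St_carrier[OF A(1)] .
  have c: "E \<in> carrier_mat n n" "?W \<in> carrier_mat n n"
    using St_carrier[OF E] St_carrier[OF W_in_St[OF B A(1)]] .
  have P: "?P \<in> carrier_mat n n"
    using index Suc.prems V St_carrier by (intro W_prod_carrier[of m n k]) auto
  have WP: "?W * ?P \<in> carrier_mat n n" using c(2) P by (rule mult_carrier_mat)
  \<comment> \<open>A symmetric orthogonal matrix is its own inverse.\<close>
  have AA: "A * A = 1\<^sub>m k" using A by (simp add: St_def)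
  have WW: "?W * ?W = 1\<^sub>m n"
    using W_mult[OF B Ac Ac] AA W_one[of n ?B] B by (simp add: index_vector_def)
  have "W_prod n B ?V m = ?P" by (rule W_prod_cong) auto
  then have "E * ?W * W_prod n B ?V (Suc m) = E * ?W * (?W * ?P)" by simp
  also have "\<dots> = E * (?W * (?W * ?P))" by (rule assoc_mult_mat[OF c WP])
  also have "?W * (?W * ?P) = ?W * ?W * ?P" by (rule assoc_mult_mat[OF c(2) c(2) P, symmetric])
  also have "E * \<dots> = D" using WW P D by simp
  finally have "D = E * ?W * W_prod n B ?V (Suc m)" by (rule sym)
  moreover have "E * ?W \<in> St n n" using St_mult[OF E W_in_St[OF B A(1)]] .
  moreover have "\<forall>i. ?V i \<in> St k k" using V A by simp
  ultimately show ?case using A(3) by blast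
qed

lemma St_eq_W_prod:
  assumes D: "D \<in> St n n" and N: "N = Suc M" and last: "set (B N) = {Suc (n - k)..n}"
  shows "\<exists>V. (\<forall>i. V i \<in> St k k) \<and> D = W_prod n B V N"
proof -
  obtain V E where V: "\<And>i. V i \<in> St k k" and E: "E \<in> St n n"
    and DE: "D = E * W_prod n B V N" and red: "reduced N E"
    using W_prod_factor[OF D order_refl] by auto
  have B: "index_vector n k (B N)" using index N by simp
  have "\<exists>A\<in>St k k. E = W n (B N) A"
  proof (rule St_eq_W[OF E B])
    fix j assume j: "j < n" "Suc j \<notin> set (B N)"
    then have "j < n - k" using last by auto
    \<comment> \<open>The bound is \<open>q = n - k\<close>; moving the premise \<open>p < q\<close>
      to the front lets the chained fact fix it. All \<open>N\<close> subsets are used, so the other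
      premises are immediate.\<close>
    then show "row E j = unit_vec n j"
      by (rule reduced_rows_unit[OF E red, rotated -1]) auto
  qed
  then obtain A where A: "A \<in> St k k" "E = W n (B N) A" by auto
  \<comment> \<open>The remainder is a factor on the same subset as the leftmost factor, so the two
    merge by \<open>W_mult\<close>.\<close>
  let ?V = "V(N := A * V N)" and ?P = "W_prod n B V M"
  have Ac: "A \<in> carrier_mat k k" and Vc: "V N \<in> carrier_mat k k"
    using St_carrier[OF A(1)] St_carrier[OF V] .
  have c: "W n (B N) A \<in> carrier_mat n n" "W n (B N) (V N) \<in> carrier_mat n n"
    using St_carrier[OF W_in_St[OF B A(1)]] St_carrier[OF W_in_St[OF B V]] .
  have P: "?P \<in> carrier_mat n n"
    using index N V St_carrier by (intro W_prod_carrier[of M n k]) auto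
  have "W_prod n B ?V M = ?P" by (rule W_prod_cong) (auto simp: N)
  then have "W_prod n B ?V N = W n (B N) (A * V N) * ?P" by (simp add: N)
  also have "\<dots> = W n (B N) A * W n (B N) (V N) * ?P" using W_mult[OF B Ac Vc] by simp
  also have "\<dots> = W n (B N) A * (W n (B N) (V N) * ?P)" by (rule assoc_mult_mat[OF c P])
  also have "\<dots> = D" using DE A(2) by (simp add: N)
  finally have "D = W_prod n B ?V N" by simp
  moreover have "\<forall>i. ?V i \<in> St k k" using V St_mult[OF A(1) V] by simp
  ultimately show ?thesis by blast
qed

end

section \<open>Minima in a lexicographic listing\<close>

lemma Min_le_Min_of_lex:
  fixes xs ys :: "nat list"
  assumes "(sort xs, sort ys) \<in> lex less_than" "xs \<noteq> []"
  shows "Min (set xs) \<le> Min (set ys)"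
proof -
  \<comment> \<open>The minimum is the head of the sorted list, and the lexicographic order compares
    heads first.\<close>
  have hd: "Min (set zs) = hd (sort zs)" if "zs \<noteq> []" for zs :: "nat list"
  proof (rule Min_eqI)
    have ne: "sort zs \<noteq> []" using that by (metis length_sort length_0_conv)
    then show "hd (sort zs) \<in> set zs" using hd_in_set[OF ne] by simp
    fix z assume "z \<in> set zs"
    then have "z \<in> set (sort zs)" by simp
    then show "hd (sort zs) \<le> z" using sorted_sort[of zs] ne by (cases "sort zs") auto
  qed simp
  \<comment> \<open>\<open>lex\<close> relates only lists of equal length, which excludes an empty
    \<open>ys\<close>.\<close>
  have "length (sort xs) = length (sort ys)"
    using assms(1) by (auto simp: lex_conv)
  then have "ys \<noteq> []" using assms(2) by auto
  obtain x xs' y ys' where eq: "sort xs = x # xs'" "sort ys = y # ys'"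
    using assms(2) \<open>ys \<noteq> []\<close> by (metis length_sort length_0_conv neq_Nil_conv)
  then have "x \<le> y" using assms(1) by auto
  then show ?thesis using hd[OF assms(2)] hd[OF \<open>ys \<noteq> []\<close>] eq by simp
qed

text \<open>The pair \<open>Suc p\<close>, \<open>Suc j\<close> is filled up to \<open>k\<close>
  elements with numbers above \<open>Suc p\<close>; the resulting subset occurs somewhere in the
  listing.\<close>

lemma combination_with_Min:
  assumes comb: "all_combinations n k B" and k: "2 \<le> k" and "p + k \<le> n" "p < j" "j < n"
  shows "\<exists>i\<in>{1..n choose k}. Min (set (B i)) = Suc p \<and> Suc j \<in> set (B i)"
proof -
  \<comment> \<open>The set has \<open>n - p - 2\<close> elements, which is enough because
    \<open>p + k \<le> n\<close>.\<close>
  have "k - 2 \<le> card ({Suc (Suc p)..n} - {Suc j})" using assms by simp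
  then obtain T where T: "T \<subseteq> {Suc (Suc p)..n} - {Suc j}" "card T = k - 2" "finite T"
    using obtain_subset_with_card_n by blast
  let ?S = "insert (Suc p) (insert (Suc j) T)"
  have S: "?S \<subseteq> {1..n}" using T assms by auto
  have "Suc p \<notin> insert (Suc j) T" "Suc j \<notin> T" using T assms by auto
  then have "card ?S = k" using T(2,3) k by simp
  with S have "?S \<in> (\<lambda>i. set (B i)) ` {1..n choose k}"
    using comb unfolding all_combinations_def bij_betw_def by blast
  then obtain i where i: "i \<in> {1..n choose k}" "set (B i) = ?S" by auto
  have "Min ?S = Suc p" using T assms by (intro Min_eqI) auto
  then show ?thesis using i by (intro bexI[of _ i]) auto
qed

lemma lex_listed_Min_mono:
  assumes comb: "all_combinations n k B" and lex: "lex_listed n k B" and k: "1 \<le> k"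
    and ij: "1 \<le> i" "i \<le> j" "j \<le> n choose k"
  shows "Min (set (B i)) \<le> Min (set (B j))"
proof (cases "i = j")
  case False
  then have "(sort (B i), sort (B j)) \<in> lex less_than"
    using lex ij unfolding lex_listed_def by simp
  moreover have "B i \<noteq> []" using comb ij k unfolding all_combinations_def index_vector_def by force
  ultimately show ?thesis by (rule Min_le_Min_of_lex)
qed simp

text \<open>The top block occurs somewhere in the listing. By monotonicity the final subset has at
  least the minimum of that block, so it lies inside the block and equals it by cardinality.\<close>

lemma lex_listed_last:
  assumes comb: "all_combinations n k B" and lex: "lex_listed n k B" and k: "1 \<le> k" "k \<le> n"
  shows "set (B (n choose k)) = {Suc (n - k)..n}"
proof -
  let ?N = "n choose k" and ?S = "{Suc (n - k)..n}"
  have "?S \<subseteq> {1..n}" "card ?S = k" using k by auto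
  then have "?S \<in> (\<lambda>i. set (B i)) ` {1..?N}"
    using comb unfolding all_combinations_def bij_betw_def by blast
  then obtain i where i: "i \<in> {1..?N}" "set (B i) = ?S" by auto
  have B: "index_vector n k (B ?N)" using comb i unfolding all_combinations_def by simp
  have "Min ?S = Suc (n - k)" using k by (intro Min_eqI) auto
  then have le: "Suc (n - k) \<le> Min (set (B ?N))"
    using lex_listed_Min_mono[OF comb lex k(1), of i ?N] i by simp
  have "set (B ?N) \<subseteq> ?S"
  proof
    fix x assume "x \<in> set (B ?N)"
    then have "Min (set (B ?N)) \<le> x" "x \<le> n"
      using B unfolding index_vector_def by auto
    then show "x \<in> ?S" using le by simp
  qed
  moreover have "card (set (B ?N)) = card ?S"
    using B k by (simp add: index_vector_def distinct_card)
  ultimately show ?thesis by (intro card_subset_eq) auto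
qed

section \<open>Factorization of orthogonal matrices and of frames\<close>

theorem corollary3p2:
  fixes n r k :: nat and B :: "nat \<Rightarrow> nat list"
  assumes "2 \<le> n" and "r \<le> n" and "2 \<le> k" and "k \<le> n"
    and "all_combinations n k B" and "lex_listed n k B"
  shows "(\<forall>i\<in>{1..n choose k}. \<forall>Bc. \<forall>V\<in>St k k. complementary n (B i) Bc \<longrightarrow>
            W n (B i) V =
              U n (B i) * V * transpose_mat (U n (B i)) + U n Bc * transpose_mat (U n Bc))
    \<and> (\<forall>D\<in>St n n. \<exists>V. (\<forall>i\<in>{1..n choose k}. V i \<in> St k k) \<and> D = W_prod n B V (n choose k))
    \<and> (\<forall>V. (\<forall>i\<in>{1..n choose k}. V i = 1\<^sub>m k) \<longrightarrow> W_prod n B V (n choose k) = 1\<^sub>m n)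
    \<and> (\<forall>X0\<in>St n r. \<forall>X\<in>St n r.
         \<exists>V. (\<forall>i\<in>{1..n choose k}. V i \<in> St k k) \<and> X = W_prod n B V (n choose k) * X0)"
proof -
  let ?N = "n choose k"
  have index: "\<And>i. i \<in> {1..?N} \<Longrightarrow> index_vector n k (B i)"
    using assms(5) by (simp add: all_combinations_def)
  have k1: "1 \<le> k" using assms(3) by simp
  interpret covering_by_minima n k ?N B
  proof
    fix p assume p: "p + k \<le> n"
    show "\<exists>i\<in>{1..?N}. Min (set (B i)) = Suc p"
      \<comment> \<open>The choice \<open>j = Suc p\<close> is below \<open>n\<close> because
        \<open>p + k \<le> n\<close> and \<open>2 \<le> k\<close>.\<close>
      using combination_with_Min[OF assms(5,3) p, of "Suc p"] p assms(3) by auto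
  qed (use k1 index lex_listed_Min_mono[OF assms(5,6) k1] combination_with_Min[OF assms(5,3)] in auto)
  \<comment> \<open>Since \<open>k \<le> n\<close>, there is at least one combination, hence a last
    factor to absorb the remainder.\<close>
  obtain M where M: "?N = Suc M" using assms(4) by (cases ?N) auto
  have surj: "\<exists>V. (\<forall>i\<in>{1..?N}. V i \<in> St k k) \<and> D = W_prod n B V ?N" if "D \<in> St n n" for D
    using St_eq_W_prod[OF that M lex_listed_last[OF assms(5,6) k1 assms(4)]] by auto
  have "\<exists>V. (\<forall>i\<in>{1..?N}. V i \<in> St k k) \<and> X = W_prod n B V ?N * X0"
    if X: "X0 \<in> St n r" "X \<in> St n r" for X0 X
  proof -
    obtain D where "D \<in> St n n" "X = D * X0" using St_transitive[OF X] by auto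
    then show ?thesis using surj by blast
  qed
  moreover have "W_prod n B V ?N = 1\<^sub>m n" if "\<forall>i\<in>{1..?N}. V i = 1\<^sub>m k" for V
    using that index by (intro W_prod_one[of _ _ k]) (auto simp: index_vector_def)
  moreover have "W n (B i) V = U n (B i) * V * transpose_mat (U n (B i)) + U n Bc * transpose_mat (U n Bc)"
    if "i \<in> {1..?N}" "V \<in> St k k" "complementary n (B i) Bc" for i Bc V
    using W_eq_complement[OF index[OF that(1)] St_carrier[OF that(2)] that(3)] .
  ultimately show ?thesis using surj by blast
qed

end
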